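(* Let $D\subset\mathbb R^2$ be a bounded domain, $V>0$, and let $u^*\in C_0^2(D)$ satisfy $u^*\ge0$ and $\int_D u^*\,dx\,dy=V$. Let $X_1=\{v\in L^2(D):\int_D v\,dx\,dy=0\}$ and $K=\{v\in X_1:\ u^*+v\ge0\}$. Given $\tilde u^{k+1}\in L^2(D)$ with $\tilde v^{k+1}=\tilde u^{k+1}-u^*\in X_1$, the following problems are equivalent (they have the same solutions $u^{k+1}$): (i) Find $u^{k+1}=v^{k+1}+u^*$ with $v^{k+1}\in K$ satisfying $$\langle\tilde v^{k+1}-v^{k+1}+\lambda,\ \phi-v^{k+1}\rangle\le0\qquad\forall\,\phi\in K,$$ where $\lambda\in\mathbb R$ is any constant. (ii) Find $u^{k+1}=v^{k+1}+u^*$ with $v^{k+1}$ satisfying $\tilde v^{k+1}-v^{k+1}\in\tau\,\partial I_K(v^{k+1})$ for all $\tau>0$. (iii) Find $u^{k+1}=v^{k+1}+u^*$ with $v^{k+1}=\mathrm{Proj}_K(\tilde u^{k+1}-u^* )$. (iv) Find $u^{k+1}$ and $\lambda\in\mathbb R$ satisfying $$u^{k+1}=\max\{\tilde u^{k+1}+\lambda,\ 0\},\qquad \int_D u^{k+1}\,dx\,dy=V .$$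
   Context: $\langle\cdot,\cdot\rangle$ is the $L^2(D)$ inner product, and $X_1$ is a Hilbert space with this inner product. $I_K:X_1\to[0,+\infty]$ is the indicator functional of $K$ ($I_K=0$ on $K$, $+\infty$ elsewhere). $\partial I_K$ is its convex subdifferential in $X_1$ (empty at points outside $K$). $\mathrm{Proj}_K$ is the orthogonal (nearest point) projection in $X_1$ onto the closed convex set $K$. Inequalities between functions are understood almost everywhere. *)

theory Defs
  imports "HOL-Analysis.Analysis"
begin

text \<open>
  Elements of \<open>L\<^sup>2(D)\<close> are represented by functions on the whole space; only their values on
  \<open>D\<close>, up to Lebesgue null sets, matter. Equality of two elements of \<open>L\<^sup>2(D)\<close> is therefore
  always written as equality almost everywhere on \<open>D\<close>.
\<close>

definition L2 :: "'a::euclidean_space set \<Rightarrow> ('a \<Rightarrow> real) set" where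
  "L2 D = {f \<in> borel_measurable (lebesgue_on D). integrable (lebesgue_on D) (\<lambda>x. (f x)\<^sup>2)}"

definition inner_L2 :: "'a::euclidean_space set \<Rightarrow> ('a \<Rightarrow> real) \<Rightarrow> ('a \<Rightarrow> real) \<Rightarrow> real" where
  "inner_L2 D f g = (LINT x|lebesgue_on D. f x * g x)"

definition norm_L2 :: "'a::euclidean_space set \<Rightarrow> ('a \<Rightarrow> real) \<Rightarrow> real" where
  "norm_L2 D f = sqrt (inner_L2 D f f)"

definition domain :: "'a::euclidean_space set \<Rightarrow> bool" where
  "domain D \<longleftrightarrow> open D \<and> connected D \<and> D \<noteq> {}"

definition C2_on :: "'a::euclidean_space set \<Rightarrow> ('a \<Rightarrow> real) \<Rightarrow> bool" where
  "C2_on D u \<longleftrightarrow>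
     (\<exists>(u' :: 'a \<Rightarrow> 'a \<Rightarrow>\<^sub>L real) (u'' :: 'a \<Rightarrow> 'a \<Rightarrow>\<^sub>L ('a \<Rightarrow>\<^sub>L real)).
        (\<forall>x\<in>D. (u has_derivative blinfun_apply (u' x)) (at x)) \<and>
        (\<forall>x\<in>D. (u' has_derivative blinfun_apply (u'' x)) (at x)) \<and>
        continuous_on D u'')"

text \<open>\<open>C\<^sub>0\<^sup>2(D)\<close>: the subscript denotes compact support contained in the open set \<open>D\<close>.\<close>

definition C2_0 :: "'a::euclidean_space set \<Rightarrow> ('a \<Rightarrow> real) set" where
  "C2_0 D = {u. C2_on D u \<and>
                compact (closure {x \<in> D. u x \<noteq> 0}) \<and> closure {x \<in> D. u x \<noteq> 0} \<subseteq> D}"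

definition X1 :: "'a::euclidean_space set \<Rightarrow> ('a \<Rightarrow> real) set" where
  "X1 D = {v \<in> L2 D. (LINT x|lebesgue_on D. v x) = 0}"

definition Kset :: "'a::euclidean_space set \<Rightarrow> ('a \<Rightarrow> real) \<Rightarrow> ('a \<Rightarrow> real) set" where
  "Kset D ustar = {v \<in> X1 D. AE x in lebesgue_on D. 0 \<le> ustar x + v x}"

definition indicator_functional :: "'b set \<Rightarrow> 'b \<Rightarrow> ereal" where
  "indicator_functional K v = (if v \<in> K then 0 else \<infinity>)"

text \<open>
  The convex subdifferential, in the space \<open>X1 D\<close>, of an extended-real-valued functional;
  it is empty at points where the functional is not finite.
\<close>

definition subdifferential ::
    "'a::euclidean_space set \<Rightarrow> (('a \<Rightarrow> real) \<Rightarrow> ereal) \<Rightarrow> ('a \<Rightarrow> real) \<Rightarrow> ('a \<Rightarrow> real) set" where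
  "subdifferential D J v =
     {p \<in> X1 D. v \<in> X1 D \<and> \<bar>J v\<bar> \<noteq> \<infinity> \<and>
        (\<forall>\<phi>\<in>X1 D. J v + ereal (inner_L2 D p (\<lambda>x. \<phi> x - v x)) \<le> J \<phi>)}"

text \<open>
  A representative of the nearest point of \<open>K\<close> to \<open>w\<close>, in the style of
  \<^const>\<open>closest_point\<close>; for closed convex \<open>K\<close> it is determined up to null sets.
\<close>

definition Proj :: "'a::euclidean_space set \<Rightarrow> ('a \<Rightarrow> real) set \<Rightarrow> ('a \<Rightarrow> real) \<Rightarrow> ('a \<Rightarrow> real)" where
  "Proj D K w = (SOME v. v \<in> K \<and>
     (\<forall>\<phi>\<in>K. norm_L2 D (\<lambda>x. w x - v x) \<le> norm_L2 D (\<lambda>x. w x - \<phi> x)))"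

text \<open>
  The equation \<open>u = v + u\<^sup>*\<close> is one in \<open>L\<^sup>2(D)\<close>, so each solution set below is closed under
  changing \<open>u\<close> on null sets. The constant \<open>lam\<close> in problem (i) is arbitrary but given, whereas in
  problem (iv) it is an unknown.
\<close>

definition solutions_i ::
    "'a::euclidean_space set \<Rightarrow> ('a \<Rightarrow> real) \<Rightarrow> ('a \<Rightarrow> real) \<Rightarrow> real \<Rightarrow> ('a \<Rightarrow> real) set" where
  "solutions_i D ustar utilde lam =
     {u. \<exists>v. (AE x in lebesgue_on D. u x = v x + ustar x) \<and> v \<in> Kset D ustar \<and>
         (\<forall>\<phi>\<in>Kset D ustar.
            inner_L2 D (\<lambda>x. (utilde x - ustar x) - v x + lam) (\<lambda>x. \<phi> x - v x) \<le> 0)}"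

definition solutions_ii ::
    "'a::euclidean_space set \<Rightarrow> ('a \<Rightarrow> real) \<Rightarrow> ('a \<Rightarrow> real) \<Rightarrow> ('a \<Rightarrow> real) set" where
  "solutions_ii D ustar utilde =
     {u. \<exists>v. (AE x in lebesgue_on D. u x = v x + ustar x) \<and>
         (\<forall>\<tau>>0. (\<lambda>x. (utilde x - ustar x) - v x) \<in>
            (\<lambda>p x. \<tau> * p x) ` subdifferential D (indicator_functional (Kset D ustar)) v)}"

definition solutions_iii ::
    "'a::euclidean_space set \<Rightarrow> ('a \<Rightarrow> real) \<Rightarrow> ('a \<Rightarrow> real) \<Rightarrow> ('a \<Rightarrow> real) set" where
  "solutions_iii D ustar utilde =
     {u. \<exists>v. (AE x in lebesgue_on D. u x = v x + ustar x) \<and>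
         (AE x in lebesgue_on D. v x = Proj D (Kset D ustar) (\<lambda>x. utilde x - ustar x) x)}"

definition solutions_iv ::
    "'a::euclidean_space set \<Rightarrow> real \<Rightarrow> ('a \<Rightarrow> real) \<Rightarrow> ('a \<Rightarrow> real) set" where
  "solutions_iv D V utilde =
     {u. \<exists>lam. (AE x in lebesgue_on D. u x = max (utilde x + lam) 0) \<and>
         (LINT x|lebesgue_on D. u x) = V}"

end

theory Submission
  imports Defs
begin

text \<open>
  Write \<open>w = utilde - ustar\<close>. By continuity and monotonicity in \<open>t\<close> of the mass of
  \<open>max (utilde + t) 0\<close>, some \<open>t\<close> gives this function the mass \<open>V\<close>; set
  \<open>v = max (utilde + t) 0 - ustar\<close>. The pointwise inequality
  \<open>(s - max s 0) * (y - max s 0) \<le> 0\<close> for \<open>y \<ge> 0\<close> shows that \<open>v\<close> solves the variational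
  inequality \<open>\<langle>w - v, \<phi> - v\<rangle> \<le> 0\<close> on \<open>K\<close>, because constants are orthogonal to mean-zero
  functions. A solution of the variational inequality satisfies
  \<open>\<parallel>w - v\<parallel>\<^sup>2 + \<parallel>\<phi> - v\<parallel>\<^sup>2 \<le> \<parallel>w - \<phi>\<parallel>\<^sup>2\<close>, so it is, up to null sets, its only solution and the only
  nearest point. Hence all four solution sets consist of the functions that agree with
  \<open>max (utilde + t) 0\<close> almost everywhere.
\<close>

section \<open>Square-integrable functions\<close>

lemma L2_measurable [measurable_dest]: "f \<in> L2 D \<Longrightarrow> f \<in> borel_measurable (lebesgue_on D)"
  by (simp add: L2_def)

lemma integrable_mult_L2:
  assumes "f \<in> L2 D" "g \<in> L2 D"
  shows "integrable (lebesgue_on D) (\<lambda>x. f x * g x)"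
proof (rule Bochner_Integration.integrable_bound)
  show "integrable (lebesgue_on D) (\<lambda>x. (f x)\<^sup>2 + (g x)\<^sup>2)"
    using assms by (simp add: L2_def)
  show "(\<lambda>x. f x * g x) \<in> borel_measurable (lebesgue_on D)"
    using assms by (auto intro!: borel_measurable_times L2_measurable)
  have "\<bar>a * b\<bar> \<le> a\<^sup>2 + b\<^sup>2" for a b :: real
  proof -
    have "2 * (\<bar>a\<bar> * \<bar>b\<bar>) \<le> a\<^sup>2 + b\<^sup>2"
      using sum_squares_bound[of "\<bar>a\<bar>" "\<bar>b\<bar>"] by (simp add: mult.assoc)
    moreover have "0 \<le> \<bar>a\<bar> * \<bar>b\<bar>"
      by simp
    ultimately show ?thesis
      unfolding abs_mult by linarith
  qed
  then show "AE x in lebesgue_on D. norm (f x * g x) \<le> norm ((f x)\<^sup>2 + (g x)\<^sup>2)"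
    by simp
qed

lemma L2_diff:
  assumes "f \<in> L2 D" "g \<in> L2 D"
  shows "(\<lambda>x. f x - g x) \<in> L2 D"
proof -
  have "integrable (lebesgue_on D) (\<lambda>x. (f x)\<^sup>2 + (g x)\<^sup>2 - 2 * (f x * g x))"
    using assms integrable_mult_L2[OF assms] by (simp add: L2_def)
  then show ?thesis
    using assms by (auto simp: L2_def power2_diff mult.assoc)
qed

lemma L2_cmult: "f \<in> L2 D \<Longrightarrow> (\<lambda>x. c * f x) \<in> L2 D"
  by (auto simp: L2_def power_mult_distrib)

lemma L2_imp_integrable:
  assumes "D \<in> lmeasurable" "f \<in> L2 D"
  shows "integrable (lebesgue_on D) f"
  using assms(2) finite_measure_lebesgue_on[OF assms(1)]
  by (auto simp: L2_def intro: finite_measure.square_integrable_imp_integrable)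

text \<open>Pointwise, \<open>(max s 0)\<^sup>2 \<le> s\<^sup>2\<close> with
  \<open>s = f x + c\<close>; the expanded square is integrable because finite measure makes both
  \<open>f\<close> and constants integrable.\<close>

lemma L2_pos_part:
  assumes "D \<in> lmeasurable" "f \<in> L2 D"
  shows "(\<lambda>x. max (f x + c) 0) \<in> L2 D"
proof -
  interpret finite_measure "lebesgue_on D"
    using assms(1) by (rule finite_measure_lebesgue_on)
  have m: "f \<in> borel_measurable (lebesgue_on D)"
    using assms(2) by (rule L2_measurable)
  have "integrable (lebesgue_on D) (\<lambda>x. (max (f x + c) 0)\<^sup>2)"
  proof (rule Bochner_Integration.integrable_bound)
    show "integrable (lebesgue_on D) (\<lambda>x. (f x)\<^sup>2 + 2 * f x * c + c\<^sup>2)"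
      using assms(2) L2_imp_integrable[OF assms] by (simp add: L2_def)
    show "(\<lambda>x. (max (f x + c) 0)\<^sup>2) \<in> borel_measurable (lebesgue_on D)"
      using m by measurable
    show "AE x in lebesgue_on D. norm ((max (f x + c) 0)\<^sup>2) \<le> norm ((f x)\<^sup>2 + 2 * f x * c + c\<^sup>2)"
    proof (rule AE_I2)
      fix x
      have "(max (f x + c) 0)\<^sup>2 \<le> (f x + c)\<^sup>2"
        by (auto simp: max_def)
      then show "norm ((max (f x + c) 0)\<^sup>2) \<le> norm ((f x)\<^sup>2 + 2 * f x * c + c\<^sup>2)"
        by (simp add: power2_sum algebra_simps)
    qed
  qed
  then show ?thesis
    using m by (auto simp: L2_def)
qed

text \<open>Extension by zero moves the claim to the complete measure \<open>lebesgue\<close>. It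
  serves problem (iv), where a solution is given only up to null sets and its measurability has to
  be derived.\<close>

lemma borel_measurable_lebesgue_on_AE:
  fixes f g :: "'a::euclidean_space \<Rightarrow> 'b::euclidean_space"
  assumes "D \<in> sets lebesgue" "f \<in> borel_measurable (lebesgue_on D)"
    and "AE x in lebesgue_on D. f x = g x"
  shows "g \<in> borel_measurable (lebesgue_on D)"
proof -
  have "(\<lambda>x. if x \<in> D then g x else 0) \<in> borel_measurable lebesgue"
  proof (rule borel_measurable_AE)
    show "(\<lambda>x. if x \<in> D then f x else 0) \<in> borel_measurable lebesgue"
      using assms(1,2) by (simp add: borel_measurable_if)
    show "AE x in lebesgue. (if x \<in> D then f x else 0) = (if x \<in> D then g x else 0)"
      using assms(1,3) by (auto simp: AE_restrict_space_iff elim!: eventually_mono)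
  qed
  then show ?thesis
    using assms(1) by (simp add: borel_measurable_if)
qed

section \<open>Variational inequality and nearest point\<close>

text \<open>Common form of problems (i) and (ii), with the constant and the scaling removed;
  geometrically, \<open>w - v\<close> lies in the normal cone to \<open>K\<close> at
  \<open>v\<close>.\<close>

definition vi_solution ::
    "'a::euclidean_space set \<Rightarrow> ('a \<Rightarrow> real) set \<Rightarrow> ('a \<Rightarrow> real) \<Rightarrow> ('a \<Rightarrow> real) \<Rightarrow> bool" where
  "vi_solution D K w v \<longleftrightarrow> v \<in> K \<and>
     (\<forall>\<phi>\<in>K. inner_L2 D (\<lambda>x. w x - v x) (\<lambda>x. \<phi> x - v x) \<le> 0)"

lemma inner_L2_self_nonneg: "0 \<le> inner_L2 D f f"
  by (simp add: inner_L2_def)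

lemma inner_L2_self_eq_0D:
  assumes "f \<in> L2 D" "inner_L2 D f f \<le> 0"
  shows "AE x in lebesgue_on D. f x = 0"
proof -
  have "(LINT x|lebesgue_on D. f x * f x) = 0"
    using assms(2) inner_L2_self_nonneg[of D f] unfolding inner_L2_def by linarith
  then show ?thesis
    by (subst (asm) integral_nonneg_eq_0_iff_AE) (auto intro: integrable_mult_L2[OF assms(1) assms(1)])
qed

lemma vi_solution_pythagoras:
  assumes "K \<subseteq> L2 D" "w \<in> L2 D" "vi_solution D K w v" "\<phi> \<in> K"
  shows "inner_L2 D (\<lambda>x. w x - v x) (\<lambda>x. w x - v x) + inner_L2 D (\<lambda>x. \<phi> x - v x) (\<lambda>x. \<phi> x - v x)
         \<le> inner_L2 D (\<lambda>x. w x - \<phi> x) (\<lambda>x. w x - \<phi> x)"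
proof -
  have "v \<in> L2 D" "\<phi> \<in> L2 D"
    using assms by (auto simp: vi_solution_def)
  then have p: "(\<lambda>x. w x - v x) \<in> L2 D" and q: "(\<lambda>x. \<phi> x - v x) \<in> L2 D"
    using assms(2) by (auto intro: L2_diff)
  have "inner_L2 D (\<lambda>x. w x - \<phi> x) (\<lambda>x. w x - \<phi> x) =
      (LINT x|lebesgue_on D. ((w x - v x) * (w x - v x) + (\<phi> x - v x) * (\<phi> x - v x))
         - 2 * ((w x - v x) * (\<phi> x - v x)))"
    unfolding inner_L2_def by (rule Bochner_Integration.integral_cong) (auto simp: algebra_simps)
  also have "\<dots> = inner_L2 D (\<lambda>x. w x - v x) (\<lambda>x. w x - v x)
      + inner_L2 D (\<lambda>x. \<phi> x - v x) (\<lambda>x. \<phi> x - v x)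
      - 2 * inner_L2 D (\<lambda>x. w x - v x) (\<lambda>x. \<phi> x - v x)"
    unfolding inner_L2_def
    using integrable_mult_L2[OF p p] integrable_mult_L2[OF q q] integrable_mult_L2[OF p q]
    by simp
  finally show ?thesis
    using assms(3,4) by (auto simp: vi_solution_def)
qed

lemma vi_solution_nearest:
  assumes "K \<subseteq> L2 D" "w \<in> L2 D" "vi_solution D K w v" "\<phi> \<in> K"
  shows "norm_L2 D (\<lambda>x. w x - v x) \<le> norm_L2 D (\<lambda>x. w x - \<phi> x)"
  using vi_solution_pythagoras[OF assms] inner_L2_self_nonneg[of D "\<lambda>x. \<phi> x - v x"]
  by (simp add: norm_L2_def)

lemma nearest_AE_eq_vi_solution:
  assumes "K \<subseteq> L2 D" "w \<in> L2 D" "vi_solution D K w v" "\<phi> \<in> K"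
    and "norm_L2 D (\<lambda>x. w x - \<phi> x) \<le> norm_L2 D (\<lambda>x. w x - v x)"
  shows "AE x in lebesgue_on D. \<phi> x = v x"
proof -
  have "inner_L2 D (\<lambda>x. \<phi> x - v x) (\<lambda>x. \<phi> x - v x) \<le> 0"
    using vi_solution_pythagoras[OF assms(1-4)] assms(5) by (simp add: norm_L2_def)
  moreover have "(\<lambda>x. \<phi> x - v x) \<in> L2 D"
    using assms by (auto simp: vi_solution_def intro!: L2_diff)
  ultimately show ?thesis
    by (auto dest: inner_L2_self_eq_0D)
qed

text \<open>Since \<open>v'\<close> is itself a nearest point, it is no farther from
  \<open>w\<close> than \<open>v\<close>, and the Pythagorean inequality at \<open>v\<close> applies
  to it.\<close>

lemma vi_solution_unique:
  assumes "K \<subseteq> L2 D" "w \<in> L2 D" "vi_solution D K w v" "vi_solution D K w v'"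
  shows "AE x in lebesgue_on D. v' x = v x"
  using assms vi_solution_nearest[OF assms(1,2,4)]
  by (intro nearest_AE_eq_vi_solution[OF assms(1-3)]) (auto simp: vi_solution_def)

text \<open>The solution \<open>v\<close> witnesses that a nearest point exists, so the choice in
  \<open>Proj\<close> does return one, and nearest points agree almost everywhere with
  \<open>v\<close>.\<close>

lemma Proj_AE_eq_vi_solution:
  assumes "K \<subseteq> L2 D" "w \<in> L2 D" "vi_solution D K w v"
  shows "AE x in lebesgue_on D. Proj D K w x = v x"
proof -
  let ?P = "\<lambda>v. v \<in> K \<and> (\<forall>\<phi>\<in>K. norm_L2 D (\<lambda>x. w x - v x) \<le> norm_L2 D (\<lambda>x. w x - \<phi> x))"
  have "v \<in> K"
    using assms(3) by (simp add: vi_solution_def)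
  moreover have "?P (Proj D K w)"
    unfolding Proj_def
    by (rule someI[where P = ?P and x = v]) (use vi_solution_nearest[OF assms] \<open>v \<in> K\<close> in auto)
  ultimately show ?thesis
    by (intro nearest_AE_eq_vi_solution[OF assms]) auto
qed

section \<open>The Lagrange multiplier\<close>

text \<open>Intermediate value theorem: the mass depends continuously on \<open>t\<close>, falls
  below \<open>V\<close> for very negative \<open>t\<close>, and reaches at least \<open>V\<close>
  for large \<open>t\<close>.\<close>

lemma (in finite_measure) exists_pos_part_integral_eq:
  fixes f :: "'a \<Rightarrow> real" and V :: real
  assumes f: "integrable M f" and "measure M (space M) > 0" and "V > 0"
  shows "\<exists>t. (LINT x|M. max (f x + t) 0) = V"
proof -
  define g where "g t = (LINT x|M. max (f x + t) 0)" for t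
  let ?m = "measure M (space M)"
  have int: "integrable M (\<lambda>x. max (f x + t) 0)" for t
    using f by simp
  \<comment> \<open>Truncation at zero is 1-Lipschitz; integrating over \<open>M\<close> yields the
    total mass as Lipschitz constant.\<close>
  have "dist (g s) (g t) \<le> ?m * dist s t" for s t
  proof -
    have "\<bar>g s - g t\<bar> = \<bar>LINT x|M. max (f x + s) 0 - max (f x + t) 0\<bar>"
      unfolding g_def using int by simp
    also have "\<dots> \<le> (LINT x|M. \<bar>max (f x + s) 0 - max (f x + t) 0\<bar>)"
      by (rule integral_abs_bound)
    also have "\<dots> \<le> (LINT x|M. \<bar>s - t\<bar>)"
      using int by (intro integral_mono) auto
    finally show ?thesis
      by (simp add: dist_real_def)
  qed
  then have "?m-lipschitz_on UNIV g"
    by (intro lipschitz_onI) auto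
  then have cont: "continuous_on UNIV g"
    by (rule lipschitz_on_continuous_on)

  \<comment> \<open>The limit at minus infinity, written with \<open>- t\<close> at
    \<open>at_top\<close>; for \<open>t \<ge> 0\<close> the integrand is dominated by
    \<open>\<bar>f x\<bar>\<close>.\<close>
  have "((\<lambda>t. LINT x|M. max (f x + (- t)) 0) \<longlongrightarrow> (LINT x|M. 0)) at_top"
  proof (rule integral_dominated_convergence_at_top)
    show "integrable M (\<lambda>x. \<bar>f x\<bar>)"
      using f by simp
    show "(\<lambda>x. max (f x + (- t)) 0) \<in> borel_measurable M" for t
      using f by auto
    show "AE x in M. ((\<lambda>t. max (f x + (- t)) 0) \<longlongrightarrow> 0) at_top"
    proof (rule AE_I2, rule tendsto_eventually)
      show "\<forall>\<^sub>F t in at_top. max (f x + (- t)) 0 = 0" for x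
        using eventually_ge_at_top[of "f x"] by eventually_elim simp
    qed
    show "\<forall>\<^sub>F t in at_top. AE x in M. norm (max (f x + (- t)) 0) \<le> \<bar>f x\<bar>"
      using eventually_ge_at_top[of 0] by eventually_elim auto
  qed simp
  then have "((\<lambda>t. g (- t)) \<longlongrightarrow> 0) at_top"
    by (simp add: g_def)
  then have "\<forall>\<^sub>F t in at_top. g (- t) < V"
    using \<open>V > 0\<close> by (rule order_tendstoD)
  then obtain a where a: "g a < V"
    by (auto dest: eventually_happens)

  \<comment> \<open>The shift for which \<open>f + b\<close>, without truncation, has integral
    exactly \<open>V\<close>; truncation can only increase it.\<close>
  define b where "b = (V - integral\<^sup>L M f) / ?m"
  have "V = (LINT x|M. f x + b)"
    using f assms(2) by (simp add: b_def)
  also have "\<dots> \<le> g b"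
    unfolding g_def using f int by (intro integral_mono) auto
  finally have b: "V \<le> g b" .
  have "a \<le> b"
  proof (rule ccontr)
    assume "\<not> a \<le> b"
    then have "g b \<le> g a"
      unfolding g_def using int by (intro integral_mono) auto
    with a b show False by simp
  qed
  then have "\<exists>t. a \<le> t \<and> t \<le> b \<and> g t = V"
    using a b cont by (intro IVT') (auto intro: continuous_on_subset)
  then show ?thesis
    unfolding g_def by blast
qed

section \<open>The solution sets\<close>

lemma X1_imp_L2: "v \<in> X1 D \<Longrightarrow> v \<in> L2 D"
  by (simp add: X1_def)

lemma X1_diff:
  assumes "D \<in> lmeasurable" "f \<in> X1 D" "g \<in> X1 D"
  shows "(\<lambda>x. f x - g x) \<in> X1 D"
  using assms by (auto simp: X1_def L2_imp_integrable intro: L2_diff)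

lemma X1_cmult: "f \<in> X1 D \<Longrightarrow> (\<lambda>x. c * f x) \<in> X1 D"
  by (simp add: X1_def L2_cmult)

lemma Kset_imp_X1: "v \<in> Kset D ustar \<Longrightarrow> v \<in> X1 D"
  by (simp add: Kset_def)

lemma Kset_subset_L2: "Kset D ustar \<subseteq> L2 D"
  by (auto simp: Kset_def X1_def)

text \<open>The constant contributes \<open>c\<close> times the integral of \<open>g\<close>, which
  is zero. This removes \<open>lam\<close> from problem (i) and lets the multiplier be inserted for
  problem (iv).\<close>

lemma inner_L2_X1_add_const:
  assumes "D \<in> lmeasurable" "f \<in> L2 D" "g \<in> X1 D"
  shows "inner_L2 D (\<lambda>x. f x + c) g = inner_L2 D f g"
proof -
  have "g \<in> L2 D" "(LINT x|lebesgue_on D. g x) = 0"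
    using assms(3) by (auto simp: X1_def)
  then show ?thesis
    using integrable_mult_L2[OF assms(2) \<open>g \<in> L2 D\<close>] L2_imp_integrable[OF assms(1) \<open>g \<in> L2 D\<close>]
    by (simp add: inner_L2_def distrib_right)
qed

lemma pos_part_vi_solution:
  assumes D: "D \<in> lmeasurable" and "utilde \<in> L2 D" and w: "(\<lambda>x. utilde x - ustar x) \<in> X1 D"
    and mass: "(LINT x|lebesgue_on D. max (utilde x + t) 0) = (LINT x|lebesgue_on D. ustar x)"
  shows "vi_solution D (Kset D ustar) (\<lambda>x. utilde x - ustar x) (\<lambda>x. max (utilde x + t) 0 - ustar x)"
    (is "vi_solution D ?K ?w ?v")
proof -
  \<comment> \<open>Square integrability of \<open>ustar\<close> is recovered by writing it as
    \<open>utilde - ?w\<close>.\<close>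
  have "(\<lambda>x. utilde x - ?w x) \<in> L2 D"
    by (intro L2_diff assms(2) X1_imp_L2[OF w])
  then have ustar: "ustar \<in> L2 D"
    by simp
  have pos: "(\<lambda>x. max (utilde x + t) 0) \<in> L2 D"
    using D assms(2) by (rule L2_pos_part)
  have "?v \<in> L2 D"
    using pos ustar by (rule L2_diff)
  then have v: "?v \<in> ?K"
    using mass L2_imp_integrable[OF D pos] L2_imp_integrable[OF D ustar]
    by (simp add: Kset_def X1_def)
  moreover have "inner_L2 D (\<lambda>x. ?w x - ?v x) (\<lambda>x. \<phi> x - ?v x) \<le> 0" if \<phi>: "\<phi> \<in> ?K" for \<phi>
  proof -
    have "inner_L2 D (\<lambda>x. ?w x - ?v x) (\<lambda>x. \<phi> x - ?v x)
        = inner_L2 D (\<lambda>x. (?w x - ?v x) + t) (\<lambda>x. \<phi> x - ?v x)"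
      by (rule inner_L2_X1_add_const[OF D X1_imp_L2, symmetric])
         (rule X1_diff[OF D] w v[THEN Kset_imp_X1] \<phi>[THEN Kset_imp_X1])+
    also have "\<dots> = (LINT x|lebesgue_on D. (?w x - ?v x + t) * (\<phi> x - ?v x))"
      by (simp add: inner_L2_def)
    also have "\<dots> \<le> 0"
    proof -
      \<comment> \<open>Applied with \<open>s = utilde x + t\<close> and
        \<open>y = ustar x + \<phi> x\<close>: then \<open>?w x - ?v x + t = s - max s 0\<close> and
        \<open>\<phi> x - ?v x = y - max s 0\<close>.\<close>
      have sign: "(s - max s 0) * (y - max s 0) \<le> 0" if "0 \<le> y" for s y :: real
        using that by (auto simp: max_def mult_nonpos_nonneg)
      have "AE x in lebesgue_on D. 0 \<le> ustar x + \<phi> x"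
        using \<phi> by (simp add: Kset_def)
      then have "AE x in lebesgue_on D. 0 \<le> - ((?w x - ?v x + t) * (\<phi> x - ?v x))"
      proof eventually_elim
        case (elim x)
        show ?case
          using sign[OF elim, of "utilde x + t"] by (simp add: algebra_simps)
      qed
      then have "0 \<le> (LINT x|lebesgue_on D. - ((?w x - ?v x + t) * (\<phi> x - ?v x)))"
        by (rule integral_nonneg_AE)
      then show ?thesis
        by simp
    qed
    finally show ?thesis .
  qed
  ultimately show ?thesis
    by (simp add: vi_solution_def)
qed

text \<open>The subdifferential of the indicator is the normal cone: finiteness forces
  \<open>v \<in> K\<close>, and the subgradient inequality is trivial for \<open>\<phi>\<close>
  outside \<open>K\<close>, where its right side is infinite.\<close>

lemma subdifferential_indicator_iff:
  assumes "K \<subseteq> X1 D"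
  shows "p \<in> subdifferential D (indicator_functional K) v \<longleftrightarrow>
    p \<in> X1 D \<and> v \<in> K \<and> (\<forall>\<phi>\<in>K. inner_L2 D p (\<lambda>x. \<phi> x - v x) \<le> 0)"
  using assms by (auto simp: subdifferential_def indicator_functional_def zero_ereal_def split: if_splits)

lemma solutions_i_iff:
  assumes "D \<in> lmeasurable" and "(\<lambda>x. utilde x - ustar x) \<in> X1 D"
  shows "u \<in> solutions_i D ustar utilde lam \<longleftrightarrow>
    (\<exists>v. (AE x in lebesgue_on D. u x = v x + ustar x) \<and>
         vi_solution D (Kset D ustar) (\<lambda>x. utilde x - ustar x) v)"
proof -
  have "inner_L2 D (\<lambda>x. utilde x - ustar x - v x + lam) (\<lambda>x. \<phi> x - v x) =
      inner_L2 D (\<lambda>x. utilde x - ustar x - v x) (\<lambda>x. \<phi> x - v x)"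
    if "v \<in> Kset D ustar" "\<phi> \<in> Kset D ustar" for v \<phi>
    by (rule inner_L2_X1_add_const[OF assms(1) X1_imp_L2])
       (rule X1_diff[OF assms(1)] assms(2) that[THEN Kset_imp_X1])+
  then show ?thesis
    by (auto simp: solutions_i_def vi_solution_def)
qed

text \<open>The normal cone is invariant under positive scaling, so the case
  \<open>\<tau> = 1\<close> already gives all others.\<close>

lemma solutions_ii_iff:
  assumes "D \<in> lmeasurable" and w: "(\<lambda>x. utilde x - ustar x) \<in> X1 D"
  shows "u \<in> solutions_ii D ustar utilde \<longleftrightarrow>
    (\<exists>v. (AE x in lebesgue_on D. u x = v x + ustar x) \<and>
         vi_solution D (Kset D ustar) (\<lambda>x. utilde x - ustar x) v)"
proof -
  let ?K = "Kset D ustar" and ?r = "\<lambda>v x. (utilde x - ustar x) - v x"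
  have sub: "?K \<subseteq> X1 D"
    by (auto simp: Kset_def)
  have "(\<forall>\<tau>>0. ?r v \<in> (\<lambda>p x. \<tau> * p x) ` subdifferential D (indicator_functional ?K) v) \<longleftrightarrow>
      vi_solution D ?K (\<lambda>x. utilde x - ustar x) v" (is "?L \<longleftrightarrow> ?R") for v
  proof
    assume ?L
    then have "?r v \<in> (\<lambda>p x. 1 * p x) ` subdifferential D (indicator_functional ?K) v"
      using zero_less_one by blast
    then show ?R
      by (simp add: subdifferential_indicator_iff[OF sub] vi_solution_def)
  next
    assume R: ?R
    show ?L
    proof (intro allI impI image_eqI)
      fix \<tau> :: real assume "\<tau> > 0"
      then show "?r v = (\<lambda>x. \<tau> * ((1 / \<tau>) * ?r v x))"
        by simp
      have "?r v \<in> X1 D"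
        using R assms by (auto simp: vi_solution_def intro: X1_diff Kset_imp_X1)
      moreover have "inner_L2 D (\<lambda>x. (1 / \<tau>) * ?r v x) \<psi> = (1 / \<tau>) * inner_L2 D (?r v) \<psi>" for \<psi>
        unfolding inner_L2_def mult.assoc by (rule integral_mult_right_zero)
      ultimately show "(\<lambda>x. (1 / \<tau>) * ?r v x) \<in> subdifferential D (indicator_functional ?K) v"
        using R \<open>\<tau> > 0\<close> X1_cmult[of "?r v" D "1 / \<tau>"]
        unfolding subdifferential_indicator_iff[OF sub] vi_solution_def
        by (auto intro!: divide_nonpos_pos)
    qed
  qed
  then show ?thesis
    by (simp add: solutions_ii_def)
qed

theorem lemma3p2:
  fixes D :: "(real ^ 2) set" and V lam :: real
    and ustar utilde :: "real ^ 2 \<Rightarrow> real"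
  assumes "domain D" and "bounded D" and "V > 0"
    and "ustar \<in> C2_0 D"
    and "AE x in lebesgue_on D. 0 \<le> ustar x"
    and "(LINT x|lebesgue_on D. ustar x) = V"
    and "utilde \<in> L2 D"
    and "(\<lambda>x. utilde x - ustar x) \<in> X1 D"
  shows "solutions_i D ustar utilde lam = solutions_ii D ustar utilde \<and>
         solutions_ii D ustar utilde = solutions_iii D ustar utilde \<and>
         solutions_iii D ustar utilde = solutions_iv D V utilde"
proof -
  let ?M = "lebesgue_on D" and ?K = "Kset D ustar" and ?w = "\<lambda>x. utilde x - ustar x"
  have "open D" "D \<noteq> {}"
    using assms(1) by (auto simp: domain_def)
  then have D: "D \<in> lmeasurable"
    using assms(2) by (auto intro: lmeasurable_open)
  then have D': "D \<in> sets lebesgue"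
    by auto
  have w: "?w \<in> L2 D"
    using assms(8) by (rule X1_imp_L2)
  have "measure lebesgue D \<noteq> 0"
    using open_not_negligible[OF \<open>open D\<close> \<open>D \<noteq> {}\<close>] D by (auto simp: negligible_iff_measure)
  then have "measure ?M (space ?M) > 0"
    using D' by (simp add: measure_restrict_space zero_less_measure_iff)
  then obtain t where t: "(LINT x|?M. max (utilde x + t) 0) = V"
    using finite_measure.exists_pos_part_integral_eq[OF finite_measure_lebesgue_on[OF D]
        L2_imp_integrable[OF D assms(7)]] assms(3) by blast
  define v0 where "v0 = (\<lambda>x. max (utilde x + t) 0 - ustar x)"
  \<comment> \<open>Stated for every admissible \<open>s\<close>, since the multiplier of a solution
    of (iv) is not known in advance to be \<open>t\<close>.\<close>
  have vi: "vi_solution D ?K ?w (\<lambda>x. max (utilde x + s) 0 - ustar x)"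
    if "(LINT x|?M. max (utilde x + s) 0) = V" for s
    using that assms(6) by (intro pos_part_vi_solution D assms(7,8)) simp
  have v0: "vi_solution D ?K ?w v0"
    unfolding v0_def using t by (rule vi)
  note unique = vi_solution_unique[OF Kset_subset_L2 w v0]
  \<comment> \<open>The almost-everywhere class of \<open>max (utilde + t) 0\<close>, to which each
    of the four solution sets is shown equal.\<close>
  define S where "S = {u. AE x in ?M. u x = v0 x + ustar x}"

  have S: "(\<exists>v. (AE x in ?M. u x = v x + ustar x) \<and> vi_solution D ?K ?w v) \<longleftrightarrow> u \<in> S" for u
  proof
    assume "\<exists>v. (AE x in ?M. u x = v x + ustar x) \<and> vi_solution D ?K ?w v"
    then obtain v where "AE x in ?M. u x = v x + ustar x" and "AE x in ?M. v x = v0 x"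
      using unique by blast
    then show "u \<in> S"
      unfolding S_def mem_Collect_eq by eventually_elim simp
  qed (use v0 in \<open>auto simp: S_def\<close>)
  have i: "solutions_i D ustar utilde lam = S" and ii: "solutions_ii D ustar utilde = S"
    using solutions_i_iff[OF D assms(8)] solutions_ii_iff[OF D assms(8)] S by auto

  have P: "AE x in ?M. Proj D ?K ?w x = v0 x"
    using Kset_subset_L2 w v0 by (rule Proj_AE_eq_vi_solution)
  have iii: "solutions_iii D ustar utilde = S"
  proof (intro set_eqI iffI)
    fix u assume "u \<in> solutions_iii D ustar utilde"
    then obtain v where "AE x in ?M. u x = v x + ustar x" "AE x in ?M. v x = Proj D ?K ?w x"
      by (auto simp: solutions_iii_def)
    with P show "u \<in> S"
      unfolding S_def mem_Collect_eq by eventually_elim simp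
  next
    fix u assume "u \<in> S"
    moreover have "AE x in ?M. v0 x = Proj D ?K ?w x"
      using P by eventually_elim simp
    ultimately show "u \<in> solutions_iii D ustar utilde"
      by (auto simp: S_def solutions_iii_def)
  qed

  \<comment> \<open>Equality of the integrals requires both functions to be measurable; for
    \<open>u\<close> this comes from completeness of Lebesgue measure.\<close>
  have mass: "(LINT x|?M. u x) = (LINT x|?M. max (utilde x + s) 0)"
    if "AE x in ?M. u x = max (utilde x + s) 0" for u s
  proof (rule integral_cong_AE)
    show m: "(\<lambda>x. max (utilde x + s) 0) \<in> borel_measurable ?M"
      using L2_pos_part[OF D assms(7)] by (rule L2_measurable)
    show "u \<in> borel_measurable ?M"
      by (rule borel_measurable_lebesgue_on_AE[OF D' m eventually_mono[OF that]]) simp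
  qed (rule that)
  have iv: "solutions_iv D V utilde = S"
  proof (intro set_eqI iffI)
    fix u assume "u \<in> solutions_iv D V utilde"
    then obtain s where s: "AE x in ?M. u x = max (utilde x + s) 0" and "(LINT x|?M. u x) = V"
      by (auto simp: solutions_iv_def)
    \<comment> \<open>Both \<open>s\<close> and \<open>t\<close> yield solutions of the same
      variational inequality, so uniqueness identifies the truncated functions without comparing the
      multipliers.\<close>
    then have "AE x in ?M. max (utilde x + s) 0 - ustar x = v0 x"
      using mass by (intro unique vi) simp
    with s show "u \<in> S"
      unfolding S_def mem_Collect_eq by eventually_elim simp
  next
    fix u assume "u \<in> S"
    then have "AE x in ?M. u x = max (utilde x + t) 0"
      by (simp add: S_def v0_def)
    then show "u \<in> solutions_iv D V utilde"
      using mass t by (auto simp: solutions_iv_def)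
  qed
  show ?thesis
    using i ii iii iv by simp
qed

end
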